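(* Let $E$ and $F$ be separable complex Banach spaces. If $T_{1}\in\mathcal{B}(E)$ satisfies the Supercyclicity Criterion and $T_{2}\in\mathcal{B}(F)$ satisfies the Tensor Supercyclicity Criterion, then $$T_{1}\widehat{\otimes}_{\pi}T_{2}: E\widehat{\otimes}_{\pi}F\longrightarrow E\widehat{\otimes}_{\pi}F$$ satisfies the Supercyclicity Criterion. Accordingly, $T_{1}\widehat{\otimes}_{\pi}T_{2}$ is supercyclic.
   Context: $\mathcal{B}(X)$ is the algebra of bounded linear operators on a Banach space $X$. Projective tensor product: for normed spaces $E,F$, the projective norm on the algebraic tensor product $E\otimes F$ is $\Pi(z)=\inf\{\sum_{j=1}^{n}\|x_j\|\,\|y_j\| : z=\sum_{j=1}^{n}x_j\otimes y_j\}$; the completion of $E\otimes F$ under $\Pi$ is denoted $E\widehat{\otimes}_{\pi}F$. $T_1\widehat{\otimes}_{\pi}T_2$ is the unique bounded linear operator on $E\widehat{\otimes}_{\pi}F$ with $(T_1\widehat{\otimes}_{\pi}T_2)(x\otimes y)=T_1x\otimes T_2y$. Supercyclic: a bounded linear operator $T$ on a Banach space $X$ is supercyclic if there is $x\in X$ such that $\{\alpha T^{n}x:\alpha\in\mathbb{C},\,n\in\mathbb{N}\}$ is dense in $X$. Supercyclicity Criterion: $T\in\mathcal{B}(X)$ satisfies it if there exist two dense subsets $D_1,D_2$ of $X$, a sequence $(n_k)_{k\ge 0}$ of positive integers, and mappings $S_{n_k}:D_2\to X$ such that (i) $\|T^{n_k}x\|\,\|S_{n_k}y\|\to 0$ for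 every $x\in D_1$ and $y\in D_2$; (ii) $T^{n_k}S_{n_k}y\to y$ for every $y\in D_2$. Tensor Supercyclicity Criterion: $T\in\mathcal{B}(X)$ satisfies it if there exist dense subsets $D_1,D_2\subset X$, an increasing sequence $(n_k)_k$ of positive integers, a sequence $(\lambda_{n_k})_{k\in\mathbb{N}}\subset\mathbb{C}\setminus\{0\}$ and a sequence of mappings $S_{n_k}:D_2\to X$ such that (i) $(\lambda_{n_k}T^{n_k}x)_{k\in\mathbb{N}}$ is bounded for all $x\in D_1$; (ii) $(\frac{1}{\lambda_{n_k}}S_{n_k}y)_{k\in\mathbb{N}}$ is bounded for all $y\in D_2$; (iii) $T^{n_k}S_{n_k}y\to y$ for all $y\in D_2$.
   Formalization: The two criteria are assumed to hold along one common sequence (n_k); with unrelated sequences for T_1 and T_2 the claim is false (bilateral weighted shifts on l^1(Z) give a counterexample). *)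

theory Defs
  imports "HOL-Analysis.Analysis"
begin

section \<open>Complex Banach spaces\<close>

class complex_vector = real_vector +
  fixes scaleC :: "complex \<Rightarrow> 'a \<Rightarrow> 'a"  (infixr "*\<^sub>C" 75)
  assumes scaleC_add_right: "c *\<^sub>C (x + y) = c *\<^sub>C x + c *\<^sub>C y"
    and scaleC_add_left: "(c + d) *\<^sub>C x = c *\<^sub>C x + d *\<^sub>C x"
    and scaleC_scaleC: "c *\<^sub>C d *\<^sub>C x = (c * d) *\<^sub>C x"
    and scaleC_of_real: "complex_of_real r *\<^sub>C x = r *\<^sub>R x"

class complex_normed_vector = complex_vector + real_normed_vector +
  assumes norm_scaleC: "norm (c *\<^sub>C x) = cmod c * norm x"

class complex_banach = complex_normed_vector + banach

instantiation complex :: complex_banach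
begin

definition scaleC_complex :: "complex \<Rightarrow> complex \<Rightarrow> complex" where
  "scaleC_complex c x = c * x"

instance
  by standard (auto simp: scaleC_complex_def algebra_simps norm_mult scaleR_conv_of_real)

end

definition clinear :: "('a::complex_vector \<Rightarrow> 'b::complex_vector) \<Rightarrow> bool" where
  "clinear f \<longleftrightarrow> (\<forall>x y. f (x + y) = f x + f y) \<and> (\<forall>c x. f (c *\<^sub>C x) = c *\<^sub>C f x)"

definition bounded_clinear :: "('a::complex_normed_vector \<Rightarrow> 'b::complex_normed_vector) \<Rightarrow> bool" where
  "bounded_clinear f \<longleftrightarrow> clinear f \<and> (\<exists>K. \<forall>x. norm (f x) \<le> K * norm x)"

definition cbilinear :: "('a::complex_vector \<Rightarrow> 'b::complex_vector \<Rightarrow> 'c::complex_vector) \<Rightarrow> bool" where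
  "cbilinear A \<longleftrightarrow> (\<forall>y. clinear (\<lambda>x. A x y)) \<and> (\<forall>x. clinear (A x))"

lemma clinear_zero: "clinear f \<Longrightarrow> f 0 = 0"
  unfolding clinear_def by (metis add_cancel_right_right)

lemma clinear_diff: "clinear f \<Longrightarrow> f (x - y) = f x - f y"
  unfolding clinear_def by (metis add_diff_cancel_right' diff_add_cancel)

lemma scaleC_minus1: "(-1) *\<^sub>C x = - x"
  using scaleC_of_real[of "-1" x] by simp

lemma bounded_clinear_bounded_linear: "bounded_clinear f \<Longrightarrow> bounded_linear f"
  unfolding bounded_clinear_def clinear_def
  by (metis bounded_linear_intro scaleC_of_real mult.commute)

lemma bounded_clinear_pos_bound:
  assumes "bounded_clinear f"
  obtains K where "K \<ge> 0" "\<And>x. norm (f x) \<le> K * norm x"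
proof -
  obtain K where "\<And>x. norm (f x) \<le> K * norm x"
    using assms unfolding bounded_clinear_def by blast
  then have "norm (f x) \<le> \<bar>K\<bar> * norm x" for x
    by (meson abs_ge_self mult_right_mono norm_ge_zero order_trans)
  then show ?thesis using that[of "\<bar>K\<bar>"] by simp
qed

section \<open>The algebraic tensor product and the projective norm\<close>

text \<open>
  The elementary tensor of \<open>x\<close> and \<open>y\<close> is the functional \<open>A \<mapsto> A x y\<close> on the space of all
  (not necessarily bounded) bilinear forms, and the algebraic tensor product is the span of these
  functionals. Scalars can be absorbed into \<open>x\<close>, so the span consists of the sums of elementary
  tensors. A list of pairs stands for the sum of the corresponding elementary tensors; the
  functionals are set to \<open>0\<close> off the bilinear forms.
\<close>

definition tensor_eval ::
  "('a::complex_vector \<times> 'b::complex_vector) list \<Rightarrow> ('a \<Rightarrow> 'b \<Rightarrow> complex) \<Rightarrow> complex" where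
  "tensor_eval xs A = (if cbilinear A then (\<Sum>(x, y)\<leftarrow>xs. A x y) else 0)"

typedef (overloaded) ('a::complex_vector, 'b::complex_vector) atensor =
  "range (tensor_eval :: ('a \<times> 'b) list \<Rightarrow> _)"
  by blast

setup_lifting type_definition_atensor

lemma tensor_eval_append: "tensor_eval (xs @ ys) = (\<lambda>A. tensor_eval xs A + tensor_eval ys A)"
  by (auto simp: tensor_eval_def)

lemma tensor_eval_scale:
  "tensor_eval (map (\<lambda>(x, y). (c *\<^sub>C x, y)) xs) = (\<lambda>A. c * tensor_eval xs A)"
proof
  fix A :: "'a \<Rightarrow> 'b \<Rightarrow> complex"
  show "tensor_eval (map (\<lambda>(x, y). (c *\<^sub>C x, y)) xs) A = c * tensor_eval xs A"
    by (induction xs)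
      (auto simp: tensor_eval_def cbilinear_def clinear_def scaleC_complex_def algebra_simps)
qed

instantiation atensor :: (complex_vector, complex_vector) complex_vector
begin

lift_definition zero_atensor :: "('a, 'b) atensor" is "\<lambda>A. 0"
  by (rule range_eqI[of _ _ "[]"]) (auto simp: tensor_eval_def)

lift_definition plus_atensor :: "('a, 'b) atensor \<Rightarrow> ('a, 'b) atensor \<Rightarrow> ('a, 'b) atensor"
  is "\<lambda>u v A. u A + v A"
  by (auto simp flip: tensor_eval_append)

lift_definition scaleC_atensor :: "complex \<Rightarrow> ('a, 'b) atensor \<Rightarrow> ('a, 'b) atensor"
  is "\<lambda>c u A. c * u A"
  by (auto simp flip: tensor_eval_scale)

lift_definition uminus_atensor :: "('a, 'b) atensor \<Rightarrow> ('a, 'b) atensor" is "\<lambda>u A. - u A"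
proof -
  fix u :: "('a \<Rightarrow> 'b \<Rightarrow> complex) \<Rightarrow> complex"
  assume "u \<in> range tensor_eval"
  then obtain xs where "u = tensor_eval xs" by blast
  then have "(\<lambda>A. - u A) = tensor_eval (map (\<lambda>(x, y). ((-1) *\<^sub>C x, y)) xs)"
    by (simp add: tensor_eval_scale)
  then show "(\<lambda>A. - u A) \<in> range tensor_eval" by blast
qed

definition minus_atensor :: "('a, 'b) atensor \<Rightarrow> ('a, 'b) atensor \<Rightarrow> ('a, 'b) atensor" where
  "minus_atensor u v = u + (- v)"

definition scaleR_atensor :: "real \<Rightarrow> ('a, 'b) atensor \<Rightarrow> ('a, 'b) atensor" where
  "scaleR_atensor r u = complex_of_real r *\<^sub>C u"

instance
proof
  fix u v w :: "('a, 'b) atensor" and c d :: complex and r s :: real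
  show "u + v + w = u + (v + w)" by transfer (auto simp: algebra_simps)
  show "u + v = v + u" by transfer (auto simp: algebra_simps)
  show "0 + u = u" by transfer auto
  show "- u + u = 0" by transfer auto
  show "u - v = u + (- v)" by (simp add: minus_atensor_def)
  show "r *\<^sub>R (u + v) = r *\<^sub>R u + r *\<^sub>R v"
    unfolding scaleR_atensor_def by transfer (auto simp: algebra_simps)
  show "(r + s) *\<^sub>R u = r *\<^sub>R u + s *\<^sub>R u"
    unfolding scaleR_atensor_def by transfer (auto simp: algebra_simps)
  show "r *\<^sub>R s *\<^sub>R u = (r * s) *\<^sub>R u"
    unfolding scaleR_atensor_def by transfer (auto simp: algebra_simps)
  show "1 *\<^sub>R u = u" unfolding scaleR_atensor_def by transfer auto
  show "c *\<^sub>C (u + v) = c *\<^sub>C u + c *\<^sub>C v" by transfer (auto simp: algebra_simps)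
  show "(c + d) *\<^sub>C u = c *\<^sub>C u + d *\<^sub>C u" by transfer (auto simp: algebra_simps)
  show "c *\<^sub>C d *\<^sub>C u = (c * d) *\<^sub>C u" by transfer (auto simp: algebra_simps)
  show "complex_of_real r *\<^sub>C u = r *\<^sub>R u" by (simp add: scaleR_atensor_def)
qed

end

lift_definition atens :: "'a::complex_vector \<Rightarrow> 'b::complex_vector \<Rightarrow> ('a, 'b) atensor"
  is "\<lambda>x y. tensor_eval [(x, y)]"
  by blast

definition asum :: "('a::complex_vector \<times> 'b::complex_vector) list \<Rightarrow> ('a, 'b) atensor" where
  "asum xs = (\<Sum>(x, y)\<leftarrow>xs. atens x y)"

lemma Rep_asum: "Rep_atensor (asum xs) = tensor_eval xs"
  by (induction xs) (auto simp: asum_def zero_atensor.rep_eq plus_atensor.rep_eq atens.rep_eq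
      tensor_eval_def fun_eq_iff)

lemma asum_append: "asum (xs @ ys) = asum xs + asum ys"
  by (simp add: asum_def)

lemma asum_scale: "asum (map (\<lambda>(x, y). (c *\<^sub>C x, y)) xs) = c *\<^sub>C asum xs"
  by (rule Rep_atensor_inject[THEN iffD1])
    (simp add: Rep_asum tensor_eval_scale scaleC_atensor.rep_eq)

lemma atensor_exhaust: obtains xs where "z = asum xs"
  by (metis Rep_asum Rep_atensor Rep_atensor_inject imageE)

lemma cbilinear_atens: "cbilinear atens"
  unfolding cbilinear_def clinear_def
  by (intro allI conjI; transfer)
    (auto simp: tensor_eval_def fun_eq_iff cbilinear_def clinear_def scaleC_complex_def)

definition projective_norm ::
  "('a::complex_normed_vector, 'b::complex_normed_vector) atensor \<Rightarrow> real" where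
  "projective_norm z =
    Inf {\<Sum>(x, y)\<leftarrow>xs. norm x * norm y | xs. z = (\<Sum>(x, y)\<leftarrow>xs. atens x y)}"

definition rep_cost :: "('a::real_normed_vector \<times> 'b::real_normed_vector) list \<Rightarrow> real" where
  "rep_cost xs = (\<Sum>(x, y)\<leftarrow>xs. norm x * norm y)"

lemma rep_cost_nonneg: "0 \<le> rep_cost xs"
  unfolding rep_cost_def by (rule sum_list_nonneg) auto

lemma projective_norm_eq: "projective_norm z = Inf {rep_cost xs | xs. z = asum xs}"
  by (simp add: projective_norm_def rep_cost_def asum_def)

lemma projective_norm_le: "projective_norm (asum xs) \<le> rep_cost xs"
  unfolding projective_norm_eq
  by (rule cInf_lower) (auto intro!: bdd_belowI[of _ 0] simp: rep_cost_nonneg)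

lemma projective_norm_approx:
  assumes "0 < e"
  obtains xs where "z = asum xs" "rep_cost xs < projective_norm z + e"
proof -
  have "{rep_cost xs | xs. z = asum xs} \<noteq> {}"
    using atensor_exhaust[of z] by blast
  from cInf_lessD[OF this, of "projective_norm z + e"] assms
  show ?thesis using that by (auto simp: projective_norm_eq)
qed

lemma projective_norm_nonneg: "0 \<le> projective_norm z"
proof (rule field_le_epsilon)
  fix e :: real assume "0 < e"
  then obtain xs where "z = asum xs" "rep_cost xs < projective_norm z + e"
    by (rule projective_norm_approx)
  then show "0 \<le> projective_norm z + e" using rep_cost_nonneg[of xs] by linarith
qed

lemma projective_norm_triangle: "projective_norm (u + v) \<le> projective_norm u + projective_norm v"
proof (rule field_le_epsilon)
  fix e :: real assume e: "0 < e"
  obtain xs where xs: "u = asum xs" "rep_cost xs < projective_norm u + e / 2"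
    using e by (meson projective_norm_approx half_gt_zero)
  obtain ys where ys: "v = asum ys" "rep_cost ys < projective_norm v + e / 2"
    using e by (meson projective_norm_approx half_gt_zero)
  have "projective_norm (u + v) \<le> rep_cost (xs @ ys)"
    using projective_norm_le[of "xs @ ys"] by (simp add: xs(1) ys(1) asum_append)
  also have "\<dots> = rep_cost xs + rep_cost ys" by (simp add: rep_cost_def)
  finally show "projective_norm (u + v) \<le> projective_norm u + projective_norm v + e"
    using xs(2) ys(2) by argo
qed

lemma rep_cost_map_le:
  assumes "0 \<le> K" "\<And>x. norm (f x) \<le> K * norm x" "0 \<le> L" "\<And>y. norm (g y) \<le> L * norm y"
  shows "rep_cost (map (\<lambda>(x, y). (f x, g y)) xs) \<le> K * L * rep_cost xs"
proof (induction xs)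
  case (Cons p xs)
  obtain x y where p: "p = (x, y)" by fastforce
  have "norm (f x) * norm (g y) \<le> (K * norm x) * (L * norm y)"
    by (intro mult_mono assms) (auto simp: assms)
  then show ?case using Cons by (simp add: rep_cost_def p algebra_simps)
qed (simp add: rep_cost_def)

lemma projective_norm_scaleC_le: "projective_norm (c *\<^sub>C u) \<le> cmod c * projective_norm u"
proof (rule field_le_epsilon)
  fix e :: real assume e: "0 < e"
  define d where "d = e / (cmod c + 1)"
  have d: "0 < d" and c1: "cmod c + 1 > 0" using e by (auto simp: d_def add_nonneg_pos)
  have de: "cmod c * d \<le> e"
    using c1 e by (simp add: d_def pos_divide_le_eq mult.commute mult_left_mono)
  obtain xs where xs: "u = asum xs" "rep_cost xs < projective_norm u + d"
    using d by (rule projective_norm_approx)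
  have "projective_norm (c *\<^sub>C u) \<le> rep_cost (map (\<lambda>(x, y). (c *\<^sub>C x, y)) xs)"
    using projective_norm_le by (metis xs(1) asum_scale)
  also have "\<dots> \<le> cmod c * 1 * rep_cost xs"
    by (rule rep_cost_map_le) (auto simp: norm_scaleC)
  also have "\<dots> \<le> cmod c * (projective_norm u + d)"
    using xs(2) by (simp add: mult_left_mono)
  also have "\<dots> \<le> cmod c * projective_norm u + e"
    using de by (simp add: distrib_left)
  finally show "projective_norm (c *\<^sub>C u) \<le> cmod c * projective_norm u + e" .
qed

lemma projective_norm_zero:
  "projective_norm (0 :: ('a::complex_normed_vector, 'b::complex_normed_vector) atensor) = 0"
proof (rule order_antisym)
  show "projective_norm (0 :: ('a, 'b) atensor) \<le> 0"
    using projective_norm_le[of "[] :: ('a \<times> 'b) list"] by (simp add: asum_def rep_cost_def)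
qed (rule projective_norm_nonneg)

lemma projective_norm_scaleC: "projective_norm (c *\<^sub>C u) = cmod c * projective_norm u"
proof (cases "c = 0")
  case True
  have "0 *\<^sub>C u = 0" using scaleC_of_real[of 0 u] by simp
  then show ?thesis by (simp add: True projective_norm_zero)
next
  case False
  have "u = inverse c *\<^sub>C c *\<^sub>C u"
    using False scaleC_of_real[of 1 u] by (simp add: scaleC_scaleC)
  then have "projective_norm u \<le> inverse (cmod c) * projective_norm (c *\<^sub>C u)"
    by (metis norm_inverse projective_norm_scaleC_le)
  then have "cmod c * projective_norm u \<le> projective_norm (c *\<^sub>C u)"
    using False by (simp add: field_simps)
  then show ?thesis using projective_norm_scaleC_le[of c u] by simp
qed

lemma projective_norm_minus: "projective_norm (- u) = projective_norm u"
  using projective_norm_scaleC[of "-1" u] by (simp add: scaleC_minus1)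

lemma projective_norm_commute: "projective_norm (u - v) = projective_norm (v - u)"
  by (metis minus_diff_eq projective_norm_minus)

lemma projective_norm_triangle3:
  "projective_norm (u - w) \<le> projective_norm (u - v) + projective_norm (v - w)"
  using projective_norm_triangle[of "u - v" "v - w"] by simp

lemma projective_norm_diff_abs: "\<bar>projective_norm u - projective_norm v\<bar> \<le> projective_norm (u - v)"
  using projective_norm_triangle[of "u - v" v] projective_norm_triangle[of "v - u" u]
  by (simp add: projective_norm_commute[of v u])

section \<open>The completion\<close>

text \<open>
  Cauchy sequences of algebraic tensors, modulo sequences tending to \<open>0\<close>. The projective norm is
  used only through the seminorm axioms: a tensor of norm \<open>0\<close> would be identified with \<open>0\<close>.
\<close>

definition pcauchy ::
  "(nat \<Rightarrow> ('a::complex_normed_vector, 'b::complex_normed_vector) atensor) \<Rightarrow> bool" where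
  "pcauchy X \<longleftrightarrow> (\<forall>e>0. \<exists>N. \<forall>m\<ge>N. \<forall>n\<ge>N. projective_norm (X m - X n) < e)"

definition ptensor_rel ::
  "(nat \<Rightarrow> ('a::complex_normed_vector, 'b::complex_normed_vector) atensor) \<Rightarrow>
    (nat \<Rightarrow> ('a, 'b) atensor) \<Rightarrow> bool" where
  "ptensor_rel X Y \<longleftrightarrow>
    pcauchy X \<and> pcauchy Y \<and> (\<lambda>n. projective_norm (X n - Y n)) \<longlonglongrightarrow> 0"

lemma null_le:
  fixes f g :: "nat \<Rightarrow> real"
  assumes "g \<longlonglongrightarrow> 0" "\<And>n. 0 \<le> f n" "\<And>n. f n \<le> g n"
  shows "f \<longlonglongrightarrow> 0"
  using tendsto_sandwich[of "\<lambda>_. 0" f sequentially g 0] assms by auto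

lemma pcauchy_const: "pcauchy (\<lambda>_. z)"
  by (simp add: pcauchy_def projective_norm_zero)

lemma ptensor_rel_equiv:
  "part_equivp (ptensor_rel ::
    (nat \<Rightarrow> ('a::complex_normed_vector, 'b::complex_normed_vector) atensor) \<Rightarrow> _)"
proof (rule part_equivpI)
  show "\<exists>X :: nat \<Rightarrow> ('a, 'b) atensor. ptensor_rel X X"
    by (rule exI[of _ "\<lambda>_. 0"]) (simp add: ptensor_rel_def pcauchy_const projective_norm_zero)
  show "symp (ptensor_rel :: (nat \<Rightarrow> ('a, 'b) atensor) \<Rightarrow> _)"
    by (rule sympI) (simp add: ptensor_rel_def projective_norm_commute)
  show "transp (ptensor_rel :: (nat \<Rightarrow> ('a, 'b) atensor) \<Rightarrow> _)"
  proof (rule transpI)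
    fix X Y Z :: "nat \<Rightarrow> ('a, 'b) atensor"
    assume XY: "ptensor_rel X Y" and YZ: "ptensor_rel Y Z"
    have "(\<lambda>n. projective_norm (X n - Y n) + projective_norm (Y n - Z n)) \<longlonglongrightarrow> 0"
      using XY YZ by (simp add: ptensor_rel_def tendsto_add_zero)
    then have "(\<lambda>n. projective_norm (X n - Z n)) \<longlonglongrightarrow> 0"
      by (rule null_le) (auto simp: projective_norm_nonneg projective_norm_triangle3)
    then show "ptensor_rel X Z" using XY YZ by (simp add: ptensor_rel_def)
  qed
qed

quotient_type (overloaded) ('a, 'b) ptensor =
  "nat \<Rightarrow> ('a::complex_normed_vector, 'b::complex_normed_vector) atensor" / partial: ptensor_rel
  by (rule ptensor_rel_equiv)

lemma pcauchy_clinear: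
  assumes f: "clinear f" and K: "\<And>z. projective_norm (f z) \<le> K * projective_norm z"
    and X: "pcauchy X"
  shows "pcauchy (\<lambda>n. f (X n))"
  unfolding pcauchy_def
proof (intro allI impI)
  fix e :: real assume e: "0 < e"
  have K1: "0 < \<bar>K\<bar> + 1" by simp
  with e have "0 < e / (\<bar>K\<bar> + 1)" by simp
  with X obtain N where N: "\<forall>m\<ge>N. \<forall>n\<ge>N. projective_norm (X m - X n) < e / (\<bar>K\<bar> + 1)"
    unfolding pcauchy_def by blast
  have "projective_norm (f (X m) - f (X n)) < e" if "m \<ge> N" "n \<ge> N" for m n
  proof -
    have "projective_norm (f (X m) - f (X n)) \<le> K * projective_norm (X m - X n)"
      using K[of "X m - X n"] by (simp add: clinear_diff[OF f])
    also have "\<dots> \<le> (\<bar>K\<bar> + 1) * projective_norm (X m - X n)"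
      by (intro mult_right_mono) (auto simp: projective_norm_nonneg)
    also have "\<dots> < e" using N that K1 by (simp add: pos_less_divide_eq mult.commute)
    finally show ?thesis .
  qed
  then show "\<exists>N. \<forall>m\<ge>N. \<forall>n\<ge>N. projective_norm (f (X m) - f (X n)) < e" by blast
qed

lemma ptensor_rel_clinear:
  assumes f: "clinear f" and K: "\<And>z. projective_norm (f z) \<le> K * projective_norm z"
    and XY: "ptensor_rel X Y"
  shows "ptensor_rel (\<lambda>n. f (X n)) (\<lambda>n. f (Y n))"
proof -
  have "(\<lambda>n. K * projective_norm (X n - Y n)) \<longlonglongrightarrow> 0"
    using XY by (simp add: ptensor_rel_def tendsto_mult_right_zero)
  then have "(\<lambda>n. projective_norm (f (X n) - f (Y n))) \<longlonglongrightarrow> 0"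
    by (rule null_le) (auto simp: projective_norm_nonneg K simp flip: clinear_diff[OF f])
  then show ?thesis
    using XY pcauchy_clinear[OF f K] by (auto simp: ptensor_rel_def)
qed

lemma clinear_scaleC: "clinear (\<lambda>x. c *\<^sub>C x)"
  by (simp add: clinear_def scaleC_add_right scaleC_scaleC mult.commute)

lemma pcauchy_add:
  assumes "pcauchy X" "pcauchy Y"
  shows "pcauchy (\<lambda>n. X n + Y n)"
  unfolding pcauchy_def
proof (intro allI impI)
  fix e :: real assume "0 < e"
  then have "0 < e / 2" by simp
  obtain M where M: "\<forall>m\<ge>M. \<forall>n\<ge>M. projective_norm (X m - X n) < e / 2"
    using assms(1) \<open>0 < e / 2\<close> unfolding pcauchy_def by blast
  obtain N where N: "\<forall>m\<ge>N. \<forall>n\<ge>N. projective_norm (Y m - Y n) < e / 2"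
    using assms(2) \<open>0 < e / 2\<close> unfolding pcauchy_def by blast
  have "projective_norm (X m + Y m - (X n + Y n)) < e" if "m \<ge> max M N" "n \<ge> max M N" for m n
  proof -
    have "projective_norm (X m - X n) < e / 2" "projective_norm (Y m - Y n) < e / 2"
      using M N that by auto
    then show ?thesis
      using projective_norm_triangle[of "X m - X n" "Y m - Y n"] by (simp add: algebra_simps)
  qed
  then show "\<exists>N. \<forall>m\<ge>N. \<forall>n\<ge>N. projective_norm (X m + Y m - (X n + Y n)) < e" by blast
qed

lemma ptensor_rel_add:
  assumes "ptensor_rel X X'" "ptensor_rel Y Y'"
  shows "ptensor_rel (\<lambda>n. X n + Y n) (\<lambda>n. X' n + Y' n)"
proof -
  have "(\<lambda>n. projective_norm (X n - X' n) + projective_norm (Y n - Y' n)) \<longlonglongrightarrow> 0"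
    using assms by (simp add: ptensor_rel_def tendsto_add_zero)
  then have "(\<lambda>n. projective_norm (X n + Y n - (X' n + Y' n))) \<longlonglongrightarrow> 0"
    by (rule null_le) (auto simp: projective_norm_nonneg add_diff_add projective_norm_triangle)
  then show ?thesis using assms by (simp add: ptensor_rel_def pcauchy_add)
qed

lemma pcauchy_norm_Cauchy:
  assumes "pcauchy X"
  shows "Cauchy (\<lambda>n. projective_norm (X n))"
  unfolding Cauchy_def dist_real_def
  using assms projective_norm_diff_abs unfolding pcauchy_def by (meson le_less_trans)

lemma pcauchy_norm_lim: "pcauchy X \<Longrightarrow> (\<lambda>n. projective_norm (X n)) \<longlonglongrightarrow> lim (\<lambda>n. projective_norm (X n))"
  using pcauchy_norm_Cauchy Cauchy_convergent convergent_LIMSEQ_iff by blast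

instantiation ptensor :: (complex_normed_vector, complex_normed_vector) complex_normed_vector
begin

lift_definition zero_ptensor :: "('a, 'b) ptensor" is "\<lambda>_. 0"
  by (simp add: ptensor_rel_def pcauchy_const projective_norm_zero)

lift_definition plus_ptensor :: "('a, 'b) ptensor \<Rightarrow> ('a, 'b) ptensor \<Rightarrow> ('a, 'b) ptensor"
  is "\<lambda>X Y n. X n + Y n"
  by (rule ptensor_rel_add)

lift_definition scaleC_ptensor :: "complex \<Rightarrow> ('a, 'b) ptensor \<Rightarrow> ('a, 'b) ptensor"
  is "\<lambda>c X n. c *\<^sub>C X n"
proof -
  fix c and X Y :: "nat \<Rightarrow> ('a, 'b) atensor"
  assume "ptensor_rel X Y"
  then show "ptensor_rel (\<lambda>n. c *\<^sub>C X n) (\<lambda>n. c *\<^sub>C Y n)"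
    by (rule ptensor_rel_clinear[OF clinear_scaleC, where K = "cmod c", rotated])
      (simp add: projective_norm_scaleC)
qed

definition scaleR_ptensor :: "real \<Rightarrow> ('a, 'b) ptensor \<Rightarrow> ('a, 'b) ptensor" where
  "scaleR_ptensor r u = complex_of_real r *\<^sub>C u"

definition uminus_ptensor :: "('a, 'b) ptensor \<Rightarrow> ('a, 'b) ptensor" where
  "uminus_ptensor u = (-1) *\<^sub>C u"

definition minus_ptensor :: "('a, 'b) ptensor \<Rightarrow> ('a, 'b) ptensor \<Rightarrow> ('a, 'b) ptensor" where
  "minus_ptensor u v = u + (- v)"

lift_definition norm_ptensor :: "('a, 'b) ptensor \<Rightarrow> real" is "\<lambda>X. lim (\<lambda>n. projective_norm (X n))"
proof -
  fix X Y :: "nat \<Rightarrow> ('a, 'b) atensor"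
  assume XY: "ptensor_rel X Y"
  have "(\<lambda>n. projective_norm (X n) - projective_norm (Y n)) \<longlonglongrightarrow> 0"
    using XY tendsto_rabs_zero_cancel[of "\<lambda>n. projective_norm (X n) - projective_norm (Y n)"]
      null_le[of "\<lambda>n. projective_norm (X n - Y n)"
        "\<lambda>n. \<bar>projective_norm (X n) - projective_norm (Y n)\<bar>"]
    by (simp add: ptensor_rel_def projective_norm_diff_abs)
  moreover have "(\<lambda>n. projective_norm (X n) - projective_norm (Y n)) \<longlonglongrightarrow>
      lim (\<lambda>n. projective_norm (X n)) - lim (\<lambda>n. projective_norm (Y n))"
    using XY by (intro tendsto_diff pcauchy_norm_lim) (auto simp: ptensor_rel_def)
  ultimately show "lim (\<lambda>n. projective_norm (X n)) = lim (\<lambda>n. projective_norm (Y n))"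
    using LIMSEQ_unique by fastforce
qed

definition dist_ptensor :: "('a, 'b) ptensor \<Rightarrow> ('a, 'b) ptensor \<Rightarrow> real" where
  "dist_ptensor u v = norm (u - v)"

definition sgn_ptensor :: "('a, 'b) ptensor \<Rightarrow> ('a, 'b) ptensor" where
  "sgn_ptensor u = inverse (norm u) *\<^sub>R u"

definition uniformity_ptensor :: "(('a, 'b) ptensor \<times> ('a, 'b) ptensor) filter" where
  "uniformity_ptensor = (INF e\<in>{0 <..}. principal {(x, y). dist x y < e})"

definition open_ptensor :: "('a, 'b) ptensor set \<Rightarrow> bool" where
  "open_ptensor U \<longleftrightarrow> (\<forall>x\<in>U. eventually (\<lambda>(x', y). x' = x \<longrightarrow> y \<in> U) uniformity)"

instance
proof
  fix u v w :: "('a, 'b) ptensor" and c d :: complex and r s :: real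
  have refl: "ptensor_rel X X" if "ptensor_rel X Y \<or> ptensor_rel Y X"
    for X Y :: "nat \<Rightarrow> ('a, 'b) atensor"
    using that by (auto simp: ptensor_rel_def projective_norm_zero)
  have rel0: "ptensor_rel (\<lambda>_. 0) (\<lambda>_. 0 :: ('a, 'b) atensor)"
    by (simp add: ptensor_rel_def pcauchy_const projective_norm_zero)
  note add = ptensor_rel_add
  have scale: "ptensor_rel (\<lambda>n. c *\<^sub>C X n) (\<lambda>n. c *\<^sub>C Y n)" if "ptensor_rel X Y"
    for X Y :: "nat \<Rightarrow> ('a, 'b) atensor" and c
    using ptensor_rel_clinear[OF clinear_scaleC _ that, of c "cmod c"]
    by (simp add: projective_norm_scaleC)
  have one: "1 *\<^sub>C x = x" for x :: "('a, 'b) atensor"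
    using scaleC_of_real[of 1 x] by simp
  show "u + v + w = u + (v + w)"
    by transfer (simp add: add.assoc add)
  show comm: "u + v = v + u"
    by transfer (subst add.commute, simp add: add)
  show zero: "0 + u = u" by transfer simp
  show "- u + u = 0"
    unfolding uminus_ptensor_def by transfer (simp add: scaleC_minus1 rel0)
  show "u - v = u + (- v)" by (simp add: minus_ptensor_def)
  show addr: "c *\<^sub>C (u + v) = c *\<^sub>C u + c *\<^sub>C v" for c
    by transfer (simp add: scaleC_add_right add scale)
  show addl: "(c + d) *\<^sub>C u = c *\<^sub>C u + d *\<^sub>C u" for c d
    by transfer (simp add: scaleC_add_left add scale)
  show sc: "c *\<^sub>C d *\<^sub>C u = (c * d) *\<^sub>C u" for c d
    by transfer (simp add: scaleC_scaleC scale)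
  show "r *\<^sub>R (u + v) = r *\<^sub>R u + r *\<^sub>R v" by (simp add: scaleR_ptensor_def addr)
  show "(r + s) *\<^sub>R u = r *\<^sub>R u + s *\<^sub>R u" by (simp add: scaleR_ptensor_def addl)
  show "r *\<^sub>R s *\<^sub>R u = (r * s) *\<^sub>R u" by (simp add: scaleR_ptensor_def sc)
  show "1 *\<^sub>R u = u" unfolding scaleR_ptensor_def by transfer (simp add: one)
  show "complex_of_real r *\<^sub>C u = r *\<^sub>R u" by (simp add: scaleR_ptensor_def)
  show "dist u v = norm (u - v)" by (simp add: dist_ptensor_def)
  show "sgn u = inverse (norm u) *\<^sub>R u" by (simp add: sgn_ptensor_def)
  show "uniformity = (INF e\<in>{0 <..}. principal {(x, y). dist (x::('a, 'b) ptensor) y < e})"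
    by (simp add: uniformity_ptensor_def)
  show "open U \<longleftrightarrow> (\<forall>x\<in>U. \<forall>\<^sub>F (x', y) in uniformity. x' = x \<longrightarrow> y \<in> U)"
    for U :: "('a, 'b) ptensor set" by (simp add: open_ptensor_def)
  show "norm u = 0 \<longleftrightarrow> u = 0"
  proof (transfer, goal_cases)
    case (1 X)
    then have X: "pcauchy X" by (simp add: ptensor_rel_def)
    have "lim (\<lambda>n. projective_norm (X n)) = 0 \<longleftrightarrow> (\<lambda>n. projective_norm (X n)) \<longlonglongrightarrow> 0"
      using pcauchy_norm_lim[OF X] limI by auto
    then show ?case by (simp add: ptensor_rel_def X pcauchy_const)
  qed
  show "norm (u + v) \<le> norm u + norm v"
  proof (transfer, goal_cases)
    case (1 X Y)
    then have X: "pcauchy X" and Y: "pcauchy Y" by (auto simp: ptensor_rel_def)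
    show ?case
      by (rule LIMSEQ_le[OF pcauchy_norm_lim[OF pcauchy_add[OF X Y]]
            tendsto_add[OF pcauchy_norm_lim[OF X] pcauchy_norm_lim[OF Y]]])
        (auto simp: projective_norm_triangle)
  qed
  show norm: "norm (c *\<^sub>C u) = cmod c * norm u" for c
  proof (transfer, goal_cases)
    case (1 c X)
    then have "pcauchy X" by (simp add: ptensor_rel_def)
    then show ?case
      by (intro limI) (simp add: projective_norm_scaleC tendsto_mult_left pcauchy_norm_lim)
  qed
  show "norm (r *\<^sub>R u) = \<bar>r\<bar> * norm u" by (simp add: scaleR_ptensor_def norm)
qed

end

definition ptensor_of :: "('a::complex_normed_vector, 'b::complex_normed_vector) atensor \<Rightarrow>
    ('a, 'b) ptensor" where
  "ptensor_of z = abs_ptensor (\<lambda>_. z)"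

lemma ptensor_rel_const: "ptensor_rel (\<lambda>_. z) (\<lambda>_. z)"
  by (simp add: ptensor_rel_def pcauchy_const projective_norm_zero)

lemma norm_ptensor_of: "norm (ptensor_of z) = projective_norm z"
  by (simp add: ptensor_of_def norm_ptensor.abs_eq ptensor_rel_const limI)

lemma clinear_ptensor_of: "clinear ptensor_of"
  by (simp add: clinear_def ptensor_of_def plus_ptensor.abs_eq scaleC_ptensor.abs_eq
      ptensor_rel_const)

lemma ptensor_of_add: "ptensor_of (u + v) = ptensor_of u + ptensor_of v"
  by (rule clinear_ptensor_of[unfolded clinear_def, THEN conjunct1, rule_format])

lemma ptensor_exhaust: obtains X where "pcauchy X" "u = abs_ptensor X"
proof
  show "u = abs_ptensor (rep_ptensor u)"
    by (simp add: Quotient3_abs_rep[OF Quotient3_ptensor])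
  show "pcauchy (rep_ptensor u)"
    using Quotient3_rep_reflp[OF Quotient3_ptensor, of u] by (simp add: ptensor_rel_def)
qed

lemma ptensor_of_tendsto:
  assumes "pcauchy X"
  shows "(\<lambda>n. ptensor_of (X n)) \<longlonglongrightarrow> abs_ptensor X"
proof (rule metric_LIMSEQ_I)
  fix e :: real assume "0 < e"
  then have "0 < e / 2" by simp
  with assms obtain N where N: "\<forall>m\<ge>N. \<forall>n\<ge>N. projective_norm (X m - X n) < e / 2"
    unfolding pcauchy_def by blast
  have "dist (ptensor_of (X n)) (abs_ptensor X) < e" if n: "n \<ge> N" for n
  proof -
    have XX: "ptensor_rel X X" using assms by (simp add: ptensor_rel_def projective_norm_zero)
    have c: "pcauchy (\<lambda>m. X n - X m)"
      using pcauchy_add[OF pcauchy_const pcauchy_clinear[OF clinear_scaleC _ assms, of "-1" 1]]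
      by (simp add: scaleC_minus1 projective_norm_minus)
    have "ptensor_of (X n) - abs_ptensor X = abs_ptensor (\<lambda>m. X n - X m)"
    proof -
      have r: "ptensor_rel (\<lambda>m. - X m) (\<lambda>m. - X m)"
        using ptensor_rel_clinear[OF clinear_scaleC _ XX, of "-1" 1]
        by (simp add: scaleC_minus1 projective_norm_minus)
      have k: "ptensor_rel (\<lambda>_. X n) (\<lambda>_. X n)"
        by (simp add: ptensor_rel_def pcauchy_const projective_norm_zero)
      show ?thesis
        by (simp add: minus_ptensor_def uminus_ptensor_def ptensor_of_def scaleC_ptensor.abs_eq[OF XX]
            plus_ptensor.abs_eq[OF k r] scaleC_minus1)
    qed
    then have "dist (ptensor_of (X n)) (abs_ptensor X) = lim (\<lambda>m. projective_norm (X n - X m))"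
      using c by (simp add: dist_norm norm_ptensor.abs_eq ptensor_rel_def projective_norm_zero)
    also have "\<dots> \<le> e / 2"
      by (rule LIMSEQ_le_const2[OF pcauchy_norm_lim[OF c]]) (use N n in \<open>auto intro: less_imp_le\<close>)
    finally show ?thesis using \<open>0 < e\<close> by simp
  qed
  then show "\<exists>N. \<forall>n\<ge>N. dist (ptensor_of (X n)) (abs_ptensor X) < e" by blast
qed

lemma ptensor_of_dense:
  "closure (range (ptensor_of ::
    ('a::complex_normed_vector, 'b::complex_normed_vector) atensor \<Rightarrow> _)) = UNIV"
proof (intro equalityI subsetI UNIV_I)
  fix u :: "('a, 'b) ptensor"
  obtain X where "pcauchy X" "u = abs_ptensor X"
    by (rule ptensor_exhaust)
  then show "u \<in> closure (range ptensor_of)"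
    using ptensor_of_tendsto[of X] unfolding closure_sequential
    by (intro exI[of _ "\<lambda>n. ptensor_of (X n)"]) simp
qed

instance ptensor :: (complex_normed_vector, complex_normed_vector) complex_banach
proof
  fix U :: "nat \<Rightarrow> ('a, 'b) ptensor"
  assume U: "Cauchy U"
  have "\<exists>z. dist (ptensor_of z) (U n) < inverse (real (Suc n))" for n
  proof -
    have "U n \<in> closure (range ptensor_of)" by (simp add: ptensor_of_dense)
    then show ?thesis unfolding closure_approachable by auto
  qed
  then obtain X where X: "\<And>n. dist (ptensor_of (X n)) (U n) < inverse (real (Suc n))" by metis
  have lim: "(\<lambda>n. dist (ptensor_of (X n)) (U n)) \<longlonglongrightarrow> 0"
    by (rule null_le[OF LIMSEQ_inverse_real_of_nat]) (auto simp only: zero_le_dist intro: less_imp_le X)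
  have "pcauchy X" unfolding pcauchy_def
  proof (intro allI impI)
    fix e :: real assume "0 < e"
    then have e: "0 < e / 3" by simp
    obtain M where M: "\<forall>n\<ge>M. dist (ptensor_of (X n)) (U n) < e / 3"
      using metric_LIMSEQ_D[OF lim e] by auto
    obtain N where N: "\<forall>m\<ge>N. \<forall>n\<ge>N. dist (U m) (U n) < e / 3"
      using U e unfolding Cauchy_def by blast
    have "projective_norm (X m - X n) < e" if "m \<ge> max M N" "n \<ge> max M N" for m n
    proof -
      have "projective_norm (X m - X n) = dist (ptensor_of (X m)) (ptensor_of (X n))"
        by (simp add: dist_norm flip: clinear_diff[OF clinear_ptensor_of] norm_ptensor_of)
      also have "\<dots> \<le> dist (ptensor_of (X m)) (U m) + dist (U m) (U n) + dist (ptensor_of (X n)) (U n)"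
        using dist_triangle[of "ptensor_of (X m)" "ptensor_of (X n)" "U m"]
          dist_triangle[of "U m" "ptensor_of (X n)" "U n"] by (simp add: dist_commute)
      also have "\<dots> < e"
      proof -
        have "dist (ptensor_of (X m)) (U m) < e / 3" "dist (U m) (U n) < e / 3"
          "dist (ptensor_of (X n)) (U n) < e / 3" using M N that by auto
        then show ?thesis by argo
      qed
      finally show ?thesis .
    qed
    then show "\<exists>N. \<forall>m\<ge>N. \<forall>n\<ge>N. projective_norm (X m - X n) < e" by blast
  qed
  then have "(\<lambda>n. ptensor_of (X n)) \<longlonglongrightarrow> abs_ptensor X" by (rule ptensor_of_tendsto)
  then have "U \<longlonglongrightarrow> abs_ptensor X"
  proof (rule Lim_transform)
    show "(\<lambda>n. U n - ptensor_of (X n)) \<longlonglongrightarrow> 0"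
      using lim by - (rule tendsto_norm_zero_cancel, simp only: dist_norm norm_minus_commute)
  qed
  then show "convergent U" by (auto simp: convergent_def)
qed

definition ptens :: "'a::complex_normed_vector \<Rightarrow> 'b::complex_normed_vector \<Rightarrow> ('a, 'b) ptensor"
    (infixl "\<otimes>\<^sub>\<pi>" 70) where
  "x \<otimes>\<^sub>\<pi> y = ptensor_of (atens x y)"

section \<open>Tensor products of operators\<close>

definition ptensor_map ::
  "('a::complex_normed_vector \<Rightarrow> 'a) \<Rightarrow> ('b::complex_normed_vector \<Rightarrow> 'b) \<Rightarrow>
    ('a, 'b) ptensor \<Rightarrow> ('a, 'b) ptensor" where
  "ptensor_map T1 T2 =
    (THE T. bounded_clinear T \<and> (\<forall>x y. T (x \<otimes>\<^sub>\<pi> y) = T1 x \<otimes>\<^sub>\<pi> T2 y))"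

lemma ptensor_of_asum: "ptensor_of (asum xs) = (\<Sum>(x, y)\<leftarrow>xs. x \<otimes>\<^sub>\<pi> y)"
proof (induction xs)
  case Nil
  then show ?case by (simp add: asum_def clinear_zero[OF clinear_ptensor_of])
next
  case (Cons p xs)
  obtain x y where "p = (x, y)" by fastforce
  then show ?case
    using Cons by (simp add: asum_def ptens_def ptensor_of_add)
qed

lemma bounded_clinear_ptensor_eqI:
  fixes S T :: "('a::complex_normed_vector, 'b::complex_normed_vector) ptensor \<Rightarrow>
    'c::complex_normed_vector"
  assumes S: "bounded_clinear S" and T: "bounded_clinear T"
    and eq: "\<And>x y. S (x \<otimes>\<^sub>\<pi> y) = T (x \<otimes>\<^sub>\<pi> y)"
  shows "S = T"
proof
  fix u :: "('a, 'b) ptensor"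
  have "S (ptensor_of (asum xs)) = T (ptensor_of (asum xs))" for xs
  proof -
    have add: "S (v + w) = S v + S w" "T (v + w) = T v + T w" and zero: "S 0 = 0" "T 0 = 0" for v w
      using S T unfolding bounded_clinear_def by (simp_all add: clinear_zero) (simp_all add: clinear_def)
    show ?thesis
      unfolding ptensor_of_asum by (induction xs) (simp_all add: add zero eq split_beta)
  qed
  then have on: "S v = T v" if "v \<in> range ptensor_of" for v
    using that by (metis atensor_exhaust rangeE)
  have "u \<in> closure (range ptensor_of)" by (simp add: ptensor_of_dense)
  then show "S u = T u"
    unfolding closure_sequential
  proof (elim exE conjE)
    fix X assume X: "\<forall>n. X n \<in> range ptensor_of" "X \<longlonglongrightarrow> u"
    have "(\<lambda>n. S (X n)) \<longlonglongrightarrow> S u" "(\<lambda>n. T (X n)) \<longlonglongrightarrow> T u"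
      by (rule bounded_linear.tendsto[OF bounded_clinear_bounded_linear X(2)], fact)+
    moreover have "(\<lambda>n. S (X n)) = (\<lambda>n. T (X n))" using on X(1) by blast
    ultimately show ?thesis by (metis LIMSEQ_unique)
  qed
qed

lemma cbilinear_comp:
  "clinear f \<Longrightarrow> clinear g \<Longrightarrow> cbilinear A \<Longrightarrow> cbilinear (\<lambda>x y. A (f x) (g y))"
  by (simp add: cbilinear_def clinear_def)

lift_definition atensor_map ::
  "('a::complex_vector \<Rightarrow> 'a) \<Rightarrow> ('b::complex_vector \<Rightarrow> 'b) \<Rightarrow> ('a, 'b) atensor \<Rightarrow> ('a, 'b) atensor"
  is "\<lambda>T1 T2 u A. if clinear T1 \<and> clinear T2 \<and> cbilinear A then u (\<lambda>x y. A (T1 x) (T2 y)) else 0"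
proof -
  fix T1 :: "'a \<Rightarrow> 'a" and T2 :: "'b \<Rightarrow> 'b" and u :: "('a \<Rightarrow> 'b \<Rightarrow> complex) \<Rightarrow> complex"
  assume "u \<in> range tensor_eval"
  then obtain xs where xs: "u = tensor_eval xs" by blast
  show "(\<lambda>A. if clinear T1 \<and> clinear T2 \<and> cbilinear A then u (\<lambda>x y. A (T1 x) (T2 y)) else 0)
      \<in> range tensor_eval"
  proof (cases "clinear T1 \<and> clinear T2")
    case True
    have "(\<lambda>A. if clinear T1 \<and> clinear T2 \<and> cbilinear A then u (\<lambda>x y. A (T1 x) (T2 y)) else 0)
        = tensor_eval (map (\<lambda>(x, y). (T1 x, T2 y)) xs)"
      by (rule ext) (simp add: xs True tensor_eval_def cbilinear_comp case_prod_unfold o_def)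
    then show ?thesis by blast
  next
    case False
    then show ?thesis by (intro range_eqI[of _ _ "[]"]) (auto simp: tensor_eval_def fun_eq_iff)
  qed
qed

lemma clinear_atensor_map: "clinear (atensor_map T1 T2)"
  unfolding clinear_def by (intro conjI allI; transfer) (auto simp: fun_eq_iff)

lemma atensor_map_asum:
  assumes "clinear T1" "clinear T2"
  shows "atensor_map T1 T2 (asum xs) = asum (map (\<lambda>(x, y). (T1 x, T2 y)) xs)"
  by (rule Rep_atensor_inject[THEN iffD1], rule ext)
    (simp add: assms atensor_map.rep_eq Rep_asum tensor_eval_def cbilinear_comp case_prod_unfold o_def)

lemma ptensor_map_exists:
  fixes T1 :: "'a::complex_normed_vector \<Rightarrow> 'a" and T2 :: "'b::complex_normed_vector \<Rightarrow> 'b"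
  assumes T1: "bounded_clinear T1" and T2: "bounded_clinear T2"
  shows "\<exists>T. bounded_clinear T \<and> (\<forall>x y. T (x \<otimes>\<^sub>\<pi> y) = T1 x \<otimes>\<^sub>\<pi> T2 y)"
proof -
  obtain K where K: "K \<ge> 0" "\<And>x. norm (T1 x) \<le> K * norm x"
    using bounded_clinear_pos_bound[OF T1] by metis
  obtain L where L: "L \<ge> 0" "\<And>y. norm (T2 y) \<le> L * norm y"
    using bounded_clinear_pos_bound[OF T2] by metis
  have lin: "clinear T1" "clinear T2" using T1 T2 by (auto simp: bounded_clinear_def)
  let ?f = "atensor_map T1 T2"
  have bound: "projective_norm (?f z) \<le> (K * L) * projective_norm z" for z
  proof (rule field_le_epsilon)
    fix e :: real assume e: "0 < e"
    define d where "d = e / (K * L + 1)"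
    have c1: "K * L + 1 > 0" using K(1) L(1) by (simp add: add_nonneg_pos)
    then have d: "0 < d" using e by (simp add: d_def)
    have de: "K * L * d \<le> e"
      using c1 e by (simp add: d_def pos_divide_le_eq mult.commute mult_left_mono)
    obtain xs where xs: "z = asum xs" "rep_cost xs < projective_norm z + d"
      using d by (rule projective_norm_approx)
    have "projective_norm (?f z) \<le> rep_cost (map (\<lambda>(x, y). (T1 x, T2 y)) xs)"
      by (simp add: xs(1) atensor_map_asum lin projective_norm_le)
    also have "\<dots> \<le> K * L * rep_cost xs" by (rule rep_cost_map_le[OF K L])
    also have "\<dots> \<le> K * L * (projective_norm z + d)"
      using xs(2) K(1) L(1) by (simp add: mult_left_mono)
    also have "\<dots> \<le> K * L * projective_norm z + e" using de by (simp add: distrib_left)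
    finally show "projective_norm (?f z) \<le> K * L * projective_norm z + e" .
  qed
  note rel = ptensor_rel_clinear[OF clinear_atensor_map bound]
  note cau = pcauchy_clinear[OF clinear_atensor_map bound]
  define T where "T = map_fun rep_ptensor abs_ptensor (\<lambda>X n. ?f (X n))"
  have T_abs: "T (abs_ptensor X) = abs_ptensor (\<lambda>n. ?f (X n))" if "pcauchy X" for X
  proof -
    have "ptensor_rel X X" using that by (simp add: ptensor_rel_def projective_norm_zero)
    then have "ptensor_rel (rep_ptensor (abs_ptensor X)) X"
      by (rule rep_abs_rsp_left[OF Quotient3_ptensor])
    from rel[OF this] show ?thesis
      unfolding T_def map_fun_def o_def id_def
      using Quotient3_rel_abs[OF Quotient3_ptensor] by fastforce
  qed
  have ex: "\<exists>X. pcauchy X \<and> u = abs_ptensor X" for u :: "('a, 'b) ptensor"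
    by (metis ptensor_exhaust)
  have refl: "ptensor_rel X X" if "pcauchy X" for X :: "nat \<Rightarrow> ('a, 'b) atensor"
    using that by (simp add: ptensor_rel_def projective_norm_zero)
  have f_add: "?f (x + y) = ?f x + ?f y" and f_sc: "?f (c *\<^sub>C x) = c *\<^sub>C ?f x" for x y c
    using clinear_atensor_map[of T1 T2] by (auto simp: clinear_def)
  have csc: "pcauchy (\<lambda>n. c *\<^sub>C X n)" if "pcauchy X" for c and X :: "nat \<Rightarrow> ('a, 'b) atensor"
    by (rule pcauchy_clinear[OF clinear_scaleC _ that, where K = "cmod c"])
      (simp add: projective_norm_scaleC)
  have "clinear T" unfolding clinear_def
  proof (intro conjI allI)
    fix u v :: "('a, 'b) ptensor" and c
    obtain X Y where X: "pcauchy X" "u = abs_ptensor X" and Y: "pcauchy Y" "v = abs_ptensor Y"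
      using ex by metis
    show "T (u + v) = T u + T v"
      using X Y by (simp add: plus_ptensor.abs_eq refl T_abs pcauchy_add cau f_add)
    show "T (c *\<^sub>C u) = c *\<^sub>C T u"
      using X by (simp add: scaleC_ptensor.abs_eq refl T_abs csc cau f_sc)
  qed
  moreover have "norm (T u) \<le> K * L * norm u" for u
  proof -
    obtain X where X: "pcauchy X" "u = abs_ptensor X" using ex by metis
    have "lim (\<lambda>n. projective_norm (?f (X n))) \<le> K * L * lim (\<lambda>n. projective_norm (X n))"
      by (rule LIMSEQ_le[OF pcauchy_norm_lim[OF cau[OF X(1)]]
            tendsto_mult_left[OF pcauchy_norm_lim[OF X(1)]]]) (use bound in auto)
    then show ?thesis using X by (simp add: T_abs norm_ptensor.abs_eq refl cau)
  qed
  moreover have "T (x \<otimes>\<^sub>\<pi> y) = T1 x \<otimes>\<^sub>\<pi> T2 y" for x y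
    using atensor_map_asum[OF lin, of "[(x, y)]"]
    by (simp add: ptens_def ptensor_of_def T_abs pcauchy_const asum_def)
  ultimately show ?thesis unfolding bounded_clinear_def by blast
qed

theorem ptensor_map_unique:
  fixes T1 :: "'a::complex_normed_vector \<Rightarrow> 'a" and T2 :: "'b::complex_normed_vector \<Rightarrow> 'b"
  assumes "bounded_clinear T1" "bounded_clinear T2"
  shows "\<exists>!T. bounded_clinear T \<and> (\<forall>x y. T (x \<otimes>\<^sub>\<pi> y) = T1 x \<otimes>\<^sub>\<pi> T2 y)"
  using ptensor_map_exists[OF assms] by (auto intro!: bounded_clinear_ptensor_eqI)

lemma
  fixes T1 :: "'a::complex_normed_vector \<Rightarrow> 'a" and T2 :: "'b::complex_normed_vector \<Rightarrow> 'b"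
  assumes "bounded_clinear T1" "bounded_clinear T2"
  shows bounded_clinear_ptensor_map: "bounded_clinear (ptensor_map T1 T2)"
    and ptensor_map_ptens: "ptensor_map T1 T2 (x \<otimes>\<^sub>\<pi> y) = T1 x \<otimes>\<^sub>\<pi> T2 y"
  using theI'[OF ptensor_map_unique[OF assms]] unfolding ptensor_map_def by blast+

section \<open>Supercyclicity\<close>

definition supercyclic :: "('a::complex_normed_vector \<Rightarrow> 'a) \<Rightarrow> bool" where
  "supercyclic T \<longleftrightarrow> bounded_clinear T \<and>
    (\<exists>x. closure {\<alpha> *\<^sub>C (T ^^ n) x | \<alpha> n. True} = UNIV)"

text \<open>
  The families \<open>S\<close> and \<open>l\<close> below are indexed by the values \<open>n k\<close> rather than by \<open>k\<close>.
  The sequence \<open>n\<close> is a parameter, so that two operators can satisfy criteria along the same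
  sequence. Tensor product theorems need this: bilateral weighted shifts on \<open>l\<^sup>1\<close>
  show that criteria satisfied along unrelated sequences do not even make the tensor product
  supercyclic.
\<close>

definition supercyclicity_criterion_along ::
  "(nat \<Rightarrow> nat) \<Rightarrow> ('a::complex_normed_vector \<Rightarrow> 'a) \<Rightarrow> bool" where
  "supercyclicity_criterion_along n T \<longleftrightarrow>
    bounded_clinear T \<and> (\<forall>k. 0 < n k) \<and>
    (\<exists>D1 D2. \<exists>S :: nat \<Rightarrow> 'a \<Rightarrow> 'a.
      closure D1 = UNIV \<and> closure D2 = UNIV \<and>
      (\<forall>x\<in>D1. \<forall>y\<in>D2. (\<lambda>k. norm ((T ^^ n k) x) * norm (S (n k) y)) \<longlonglongrightarrow> 0) \<and>
      (\<forall>y\<in>D2. (\<lambda>k. (T ^^ n k) (S (n k) y)) \<longlonglongrightarrow> y))"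

definition supercyclicity_criterion :: "('a::complex_normed_vector \<Rightarrow> 'a) \<Rightarrow> bool" where
  "supercyclicity_criterion T \<longleftrightarrow> (\<exists>n. supercyclicity_criterion_along n T)"

definition tensor_supercyclicity_criterion_along ::
  "(nat \<Rightarrow> nat) \<Rightarrow> ('a::complex_normed_vector \<Rightarrow> 'a) \<Rightarrow> bool" where
  "tensor_supercyclicity_criterion_along n T \<longleftrightarrow>
    bounded_clinear T \<and> strict_mono n \<and> (\<forall>k. 0 < n k) \<and>
    (\<exists>D1 D2. \<exists>l :: nat \<Rightarrow> complex. \<exists>S :: nat \<Rightarrow> 'a \<Rightarrow> 'a.
      closure D1 = UNIV \<and> closure D2 = UNIV \<and> (\<forall>k. l (n k) \<noteq> 0) \<and>
      (\<forall>x\<in>D1. bounded (range (\<lambda>k. l (n k) *\<^sub>C (T ^^ n k) x))) \<and>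
      (\<forall>y\<in>D2. bounded (range (\<lambda>k. (1 / l (n k)) *\<^sub>C S (n k) y))) \<and>
      (\<forall>y\<in>D2. (\<lambda>k. (T ^^ n k) (S (n k) y)) \<longlonglongrightarrow> y))"

definition tensor_supercyclicity_criterion :: "('a::complex_normed_vector \<Rightarrow> 'a) \<Rightarrow> bool" where
  "tensor_supercyclicity_criterion T \<longleftrightarrow> (\<exists>n. tensor_supercyclicity_criterion_along n T)"

end

theory Submission
  imports Defs
begin

text \<open>
  Elementary tensors satisfy \<open>\<parallel>x \<otimes> y\<parallel> \<le> \<parallel>x\<parallel> \<parallel>y\<parallel>\<close>. For \<open>x \<in> D1\<close>, \<open>y \<in> D2\<close> from the criterion of
  \<open>T1\<close> (with maps \<open>S\<close>) and \<open>x' \<in> D1'\<close>, \<open>y' \<in> D2'\<close> from that of \<open>T2\<close> (with maps \<open>S'\<close> and scalars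
  \<open>l\<close>), the scalars cancel in
  \<open>\<parallel>T1\<^sup>n x \<otimes> T2\<^sup>n x'\<parallel> \<parallel>S\<^sub>n y \<otimes> S'\<^sub>n y'\<parallel> \<le>
    (\<parallel>T1\<^sup>n x\<parallel> \<parallel>S\<^sub>n y\<parallel>) \<parallel>l\<^sub>n T2\<^sup>n x'\<parallel> \<parallel>l\<^sub>n\<^sup>-\<^sup>1 S'\<^sub>n y'\<parallel>\<close>,
  so that along the common sequence a null factor meets two bounded ones. Moreover
  \<open>T1\<^sup>n S\<^sub>n y \<otimes> T2\<^sup>n S'\<^sub>n y'\<close> tends to \<open>y \<otimes> y'\<close> by joint continuity of the tensor map. Both facts pass
  to finite sums of elementary tensors, and the finite sums of tensors \<open>x \<otimes> x'\<close> with \<open>x\<close> and \<open>x'\<close>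
  taken from dense sets are dense (\<open>closure_tensor_sums\<close>). This gives the Supercyclicity Criterion for
  the tensor product (\<open>supercyclicity_criterion_along_ptensor_map\<close>).

  The criterion makes an operator transitive up to scalars: the orbit of some point of any given
  ball, multiplied by a suitable scalar, enters any other given ball
  (\<open>supercyclicity_criterion_transitive\<close>). On a separable Banach space the Baire category theorem
  then yields a single vector whose scaled orbit enters all balls of a countable family that
  determines density (\<open>supercyclicity_criterion_imp_supercyclic\<close>). It applies here because the
  density statement for sums of elementary tensors also shows that the projective tensor product of
  separable spaces is separable.
\<close>

section \<open>Elementary tensors and their finite sums\<close>

lemma norm_ptens_le: "norm (x \<otimes>\<^sub>\<pi> y) \<le> norm x * norm y"
  using projective_norm_le[of "[(x, y)]"]
  by (simp add: ptens_def norm_ptensor_of asum_def rep_cost_def)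

lemma bounded_bilinear_ptens: "bounded_bilinear ptens"
proof
  fix x x' :: "'a::complex_normed_vector" and y y' :: "'b::complex_normed_vector" and r :: real
  have add: "(x + x') \<otimes>\<^sub>\<pi> y = x \<otimes>\<^sub>\<pi> y + x' \<otimes>\<^sub>\<pi> y" "x \<otimes>\<^sub>\<pi> (y + y') = x \<otimes>\<^sub>\<pi> y + x \<otimes>\<^sub>\<pi> y'"
    and scale: "(c *\<^sub>C x) \<otimes>\<^sub>\<pi> y = c *\<^sub>C (x \<otimes>\<^sub>\<pi> y)" "x \<otimes>\<^sub>\<pi> (c *\<^sub>C y) = c *\<^sub>C (x \<otimes>\<^sub>\<pi> y)" for c
    using cbilinear_atens[where 'a='a and 'b='b] clinear_ptensor_of[where 'a='a and 'b='b]
    by (simp_all add: ptens_def cbilinear_def clinear_def)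
  show "(x + x') \<otimes>\<^sub>\<pi> y = x \<otimes>\<^sub>\<pi> y + x' \<otimes>\<^sub>\<pi> y" "x \<otimes>\<^sub>\<pi> (y + y') = x \<otimes>\<^sub>\<pi> y + x \<otimes>\<^sub>\<pi> y'"
    by (fact add)+
  show "(r *\<^sub>R x) \<otimes>\<^sub>\<pi> y = r *\<^sub>R (x \<otimes>\<^sub>\<pi> y)" "x \<otimes>\<^sub>\<pi> (r *\<^sub>R y) = r *\<^sub>R (x \<otimes>\<^sub>\<pi> y)"
    using scale[of "complex_of_real r"] by (simp_all add: scaleC_of_real)
next
  show "\<exists>K. \<forall>(x::'a) (y::'b). norm (x \<otimes>\<^sub>\<pi> y) \<le> norm x * norm y * K"
    by (rule exI[of _ 1]) (simp add: norm_ptens_le)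
qed

definition tensor_sums ::
  "'a::complex_normed_vector set \<Rightarrow> 'b::complex_normed_vector set \<Rightarrow> ('a, 'b) ptensor set" where
  "tensor_sums A B = {\<Sum>(x, y)\<leftarrow>xs. x \<otimes>\<^sub>\<pi> y | xs. set xs \<subseteq> A \<times> B}"

lemma tensor_sums_Cons:
  assumes "x \<in> A" "y \<in> B" "v \<in> tensor_sums A B"
  shows "x \<otimes>\<^sub>\<pi> y + v \<in> tensor_sums A B"
proof -
  obtain xs where "set xs \<subseteq> A \<times> B" "v = (\<Sum>(x, y)\<leftarrow>xs. x \<otimes>\<^sub>\<pi> y)"
    using assms(3) by (auto simp: tensor_sums_def)
  then show ?thesis
    unfolding tensor_sums_def using assms(1,2) by (intro CollectI exI[of _ "(x, y) # xs"]) auto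
qed

text \<open>
  Each of the finitely many elementary tensors in a sum may be approximated on its own. Scalar
  coefficients can be absorbed into the left factors before approximating, which is why plain sums
  suffice although \<open>A\<close> and \<open>B\<close> need not be closed under scalar multiplication.
\<close>

lemma closure_tensor_sums:
  fixes A :: "'a::complex_normed_vector set" and B :: "'b::complex_normed_vector set"
  assumes "closure A = UNIV" "closure B = UNIV"
  shows "closure (tensor_sums A B) = UNIV"
proof -
  have "(\<Sum>(x, y)\<leftarrow>xs. x \<otimes>\<^sub>\<pi> y) \<in> closure (tensor_sums A B)" for xs :: "('a \<times> 'b) list"
  proof (induction xs)
    case Nil
    have "0 \<in> tensor_sums A B"
      unfolding tensor_sums_def by (intro CollectI exI[of _ "[]"]) simp
    then show ?case using closure_subset by auto
  next
    case (Cons p xs)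
    obtain x y where p: "p = (x, y)" by fastforce
    have "x \<in> closure A" "y \<in> closure B" using assms by auto
    with Cons obtain X Y V where lims: "\<forall>n. X n \<in> A" "X \<longlonglongrightarrow> x" "\<forall>n. Y n \<in> B" "Y \<longlonglongrightarrow> y"
      "\<forall>n. V n \<in> tensor_sums A B" "V \<longlonglongrightarrow> (\<Sum>(x, y)\<leftarrow>xs. x \<otimes>\<^sub>\<pi> y)"
      unfolding closure_sequential by blast
    then have "(\<lambda>n. X n \<otimes>\<^sub>\<pi> Y n + V n) \<longlonglongrightarrow> x \<otimes>\<^sub>\<pi> y + (\<Sum>(x, y)\<leftarrow>xs. x \<otimes>\<^sub>\<pi> y)"
      by (intro tendsto_add bounded_bilinear.tendsto[OF bounded_bilinear_ptens])
    moreover have "\<forall>n. X n \<otimes>\<^sub>\<pi> Y n + V n \<in> tensor_sums A B"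
      using lims by (blast intro: tensor_sums_Cons)
    ultimately show ?case unfolding closure_sequential p by auto
  qed
  then have "range (ptensor_of :: ('a, 'b) atensor \<Rightarrow> _) \<subseteq> closure (tensor_sums A B)"
    by (metis (no_types, lifting) atensor_exhaust image_subsetI ptensor_of_asum)
  then have "closure (range (ptensor_of :: ('a, 'b) atensor \<Rightarrow> _)) \<subseteq> closure (tensor_sums A B)"
    by (simp add: closure_minimal)
  then show ?thesis using ptensor_of_dense by blast
qed

lemma separable_space_euclidean_iff:
  "separable_space (euclidean :: 'a::topological_space topology) \<longleftrightarrow>
    (\<exists>C :: 'a set. countable C \<and> closure C = UNIV)"
  by (simp add: separable_space_def)

lemma separable_space_ptensor:
  assumes "separable_space (euclidean :: 'a::complex_normed_vector topology)"
    and "separable_space (euclidean :: 'b::complex_normed_vector topology)"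
  shows "separable_space (euclidean :: ('a, 'b) ptensor topology)"
proof -
  obtain A :: "'a set" and B :: "'b set"
    where A: "countable A" "closure A = UNIV" and B: "countable B" "closure B = UNIV"
    using assms by (auto simp: separable_space_euclidean_iff)
  have "tensor_sums A B = (\<lambda>xs. \<Sum>(x, y)\<leftarrow>xs. x \<otimes>\<^sub>\<pi> y) ` lists (A \<times> B)"
    unfolding tensor_sums_def lists_eq_set by blast
  then have "countable (tensor_sums A B)" using A B by auto
  then show ?thesis
    using closure_tensor_sums[OF A(2) B(2)] by (auto simp: separable_space_euclidean_iff)
qed

section \<open>The criterion for the tensor product\<close>

lemma bounded_clinear_funpow:
  fixes T :: "'a::complex_normed_vector \<Rightarrow> 'a"
  assumes "bounded_clinear T"
  shows "bounded_clinear (T ^^ n)"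
proof (induction n)
  case 0
  have "\<exists>K. \<forall>x. norm x \<le> K * norm x" by (rule exI[of _ 1]) simp
  then show ?case by (simp add: bounded_clinear_def clinear_def)
next
  case (Suc n)
  obtain K where K: "K \<ge> 0" "\<And>x. norm (T x) \<le> K * norm x"
    using bounded_clinear_pos_bound[OF assms] by metis
  obtain L where L: "L \<ge> 0" "\<And>x. norm ((T ^^ n) x) \<le> L * norm x"
    using bounded_clinear_pos_bound[OF Suc] by metis
  have "norm (T ((T ^^ n) x)) \<le> K * L * norm x" for x
    using K(2)[of "(T ^^ n) x"] mult_left_mono[OF L(2)[of x] K(1)] by (simp add: mult.assoc)
  then show ?case
    using assms Suc by (auto simp: bounded_clinear_def clinear_def)
qed

lemma clinear_sum_list: "clinear f \<Longrightarrow> f (\<Sum>a\<leftarrow>xs. g a) = (\<Sum>a\<leftarrow>xs. f (g a))"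
  by (induction xs) (auto simp: clinear_zero, auto simp: clinear_def)

lemma ptensor_map_funpow_ptens:
  assumes "bounded_clinear T1" "bounded_clinear T2"
  shows "(ptensor_map T1 T2 ^^ n) (x \<otimes>\<^sub>\<pi> y) = (T1 ^^ n) x \<otimes>\<^sub>\<pi> (T2 ^^ n) y"
  by (induction n) (simp_all add: ptensor_map_ptens assms)

lemma ptensor_map_funpow_sum_list:
  assumes "bounded_clinear T1" "bounded_clinear T2"
  shows "(ptensor_map T1 T2 ^^ n) (\<Sum>p\<leftarrow>xs. f p \<otimes>\<^sub>\<pi> g p) =
    (\<Sum>p\<leftarrow>xs. (T1 ^^ n) (f p) \<otimes>\<^sub>\<pi> (T2 ^^ n) (g p))"
  using bounded_clinear_funpow[OF bounded_clinear_ptensor_map[OF assms]]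
  by (simp add: bounded_clinear_def clinear_sum_list ptensor_map_funpow_ptens[OF assms])

lemma sum_list_norm_mult_tendsto_0:
  fixes f :: "'i \<Rightarrow> 'c \<Rightarrow> 'a::real_normed_vector" and c :: "'i \<Rightarrow> real"
  assumes "\<And>a. a \<in> set xs \<Longrightarrow> ((\<lambda>k. norm (f k a) * c k) \<longlongrightarrow> 0) F" and "\<And>k. 0 \<le> c k"
  shows "((\<lambda>k. norm (\<Sum>a\<leftarrow>xs. f k a) * c k) \<longlongrightarrow> 0) F"
  using assms(1)
proof (induction xs)
  case (Cons a xs)
  have "((\<lambda>k. norm (f k a) * c k + norm (\<Sum>a\<leftarrow>xs. f k a) * c k) \<longlongrightarrow> 0) F"
    using Cons by (intro tendsto_add_zero) auto
  then show ?case
  proof (rule tendsto_0_le[where K = 1], intro always_eventually allI)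
    fix k
    show "norm (norm (\<Sum>a\<leftarrow>a # xs. f k a) * c k)
        \<le> norm (norm (f k a) * c k + norm (\<Sum>a\<leftarrow>xs. f k a) * c k) * 1"
      using mult_right_mono[OF norm_triangle_ineq[of "f k a" "\<Sum>a\<leftarrow>xs. f k a"] assms(2)[of k]]
        assms(2)[of k]
      by (simp add: distrib_right abs_of_nonneg)
  qed
qed simp

lemma tendsto_sum_list:
  fixes f :: "'i \<Rightarrow> 'c \<Rightarrow> 'a::real_normed_vector"
  assumes "\<And>a. a \<in> set xs \<Longrightarrow> ((\<lambda>k. f k a) \<longlongrightarrow> g a) F"
  shows "((\<lambda>k. \<Sum>a\<leftarrow>xs. f k a) \<longlongrightarrow> (\<Sum>a\<leftarrow>xs. g a)) F"
  using assms by (induction xs) (auto intro!: tendsto_add)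

text \<open>
  The scalars \<open>l k\<close> of the Tensor Supercyclicity Criterion enter only here, and cancel: the product
  is dominated by the null sequence of the first operator times two bounded sequences of the second.
\<close>

lemma ptens_norm_mult_tendsto_0:
  fixes u v :: "nat \<Rightarrow> 'a::complex_normed_vector" and u' v' :: "nat \<Rightarrow> 'b::complex_normed_vector"
  assumes null: "(\<lambda>k. norm (u k) * norm (v k)) \<longlonglongrightarrow> 0"
    and bdd: "bounded (range (\<lambda>k. l k *\<^sub>C u' k))" "bounded (range (\<lambda>k. (1 / l k) *\<^sub>C v' k))"
    and l: "\<And>k. l k \<noteq> 0"
  shows "(\<lambda>k. norm (u k \<otimes>\<^sub>\<pi> u' k) * norm (v k \<otimes>\<^sub>\<pi> v' k)) \<longlonglongrightarrow> 0"
proof -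
  obtain B where B: "B > 0" "\<And>k. norm (l k *\<^sub>C u' k) \<le> B"
    using bdd(1) by (auto simp: bounded_pos)
  obtain C where C: "C > 0" "\<And>k. norm ((1 / l k) *\<^sub>C v' k) \<le> C"
    using bdd(2) by (auto simp: bounded_pos)
  show ?thesis
    using null
  proof (rule tendsto_0_le[where K = "B * C"], intro always_eventually allI)
    fix k
    have "norm (u k \<otimes>\<^sub>\<pi> u' k) * norm (v k \<otimes>\<^sub>\<pi> v' k)
        \<le> (norm (u k) * norm (u' k)) * (norm (v k) * norm (v' k))"
      by (intro mult_mono norm_ptens_le) auto
    also have "\<dots> = (norm (u k) * norm (v k))
        * (norm (l k *\<^sub>C u' k) * norm ((1 / l k) *\<^sub>C v' k))"
      using l[of k] by (simp add: norm_scaleC norm_divide field_simps)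
    also have "\<dots> \<le> (norm (u k) * norm (v k)) * (B * C)"
      using B C by (intro mult_left_mono mult_mono) (auto intro: less_imp_le)
    finally show "norm (norm (u k \<otimes>\<^sub>\<pi> u' k) * norm (v k \<otimes>\<^sub>\<pi> v' k))
        \<le> norm (norm (u k) * norm (v k)) * (B * C)"
      by simp
  qed
qed

theorem supercyclicity_criterion_along_ptensor_map:
  fixes T1 :: "'a::complex_normed_vector \<Rightarrow> 'a" and T2 :: "'b::complex_normed_vector \<Rightarrow> 'b"
  assumes "supercyclicity_criterion_along n T1"
    and "tensor_supercyclicity_criterion_along n T2"
  shows "supercyclicity_criterion_along n (ptensor_map T1 T2)"
proof -
  obtain D1 D2 S where T1: "bounded_clinear T1" and n: "\<forall>k. 0 < n k"
    and D: "closure D1 = UNIV" "closure D2 = UNIV"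
    and null: "\<And>x y. x \<in> D1 \<Longrightarrow> y \<in> D2 \<Longrightarrow> (\<lambda>k. norm ((T1 ^^ n k) x) * norm (S (n k) y)) \<longlonglongrightarrow> 0"
    and inv: "\<And>y. y \<in> D2 \<Longrightarrow> (\<lambda>k. (T1 ^^ n k) (S (n k) y)) \<longlonglongrightarrow> y"
    using assms(1) unfolding supercyclicity_criterion_along_def by blast
  obtain D1' D2' l S' where T2: "bounded_clinear T2"
    and D': "closure D1' = UNIV" "closure D2' = UNIV" and l: "\<And>k. l (n k) \<noteq> (0 :: complex)"
    and bdd: "\<And>x. x \<in> D1' \<Longrightarrow> bounded (range (\<lambda>k. l (n k) *\<^sub>C (T2 ^^ n k) x))"
      "\<And>y. y \<in> D2' \<Longrightarrow> bounded (range (\<lambda>k. (1 / l (n k)) *\<^sub>C S' (n k) y))"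
    and inv': "\<And>y. y \<in> D2' \<Longrightarrow> (\<lambda>k. (T2 ^^ n k) (S' (n k) y)) \<longlonglongrightarrow> y"
    using assms(2) unfolding tensor_supercyclicity_criterion_along_def by blast
  let ?T = "ptensor_map T1 T2"
  \<comment> \<open>The maps \<open>S\<close> and \<open>S'\<close> are arbitrary functions, so the image of a sum depends on how it is
    written. One way of writing each element is fixed.\<close>
  have "\<forall>z\<in>tensor_sums D2 D2'. \<exists>ys. set ys \<subseteq> D2 \<times> D2' \<and> z = (\<Sum>p\<leftarrow>ys. fst p \<otimes>\<^sub>\<pi> snd p)"
    by (auto simp: tensor_sums_def case_prod_unfold)
  then obtain R where R: "\<And>z. z \<in> tensor_sums D2 D2' \<Longrightarrow>
      set (R z) \<subseteq> D2 \<times> D2' \<and> z = (\<Sum>p\<leftarrow>R z. fst p \<otimes>\<^sub>\<pi> snd p)"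
    by metis
  define Q where "Q m z = (\<Sum>p\<leftarrow>R z. S m (fst p) \<otimes>\<^sub>\<pi> S' m (snd p))" for m z
  have "(\<lambda>k. norm ((?T ^^ n k) w) * norm (Q (n k) z)) \<longlonglongrightarrow> 0"
    if w: "w \<in> tensor_sums D1 D1'" and z: "z \<in> tensor_sums D2 D2'" for w z
  proof -
    obtain xs where xs: "set xs \<subseteq> D1 \<times> D1'" and w: "w = (\<Sum>p\<leftarrow>xs. fst p \<otimes>\<^sub>\<pi> snd p)"
      using w by (auto simp: tensor_sums_def case_prod_unfold)
    have "(\<lambda>k. norm ((T1 ^^ n k) (fst p) \<otimes>\<^sub>\<pi> (T2 ^^ n k) (snd p))
        * norm (S (n k) (fst q) \<otimes>\<^sub>\<pi> S' (n k) (snd q))) \<longlonglongrightarrow> 0"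
      if "p \<in> set xs" "q \<in> set (R z)" for p q
    proof (rule ptens_norm_mult_tendsto_0[where l = "\<lambda>k. l (n k)"])
      have "fst p \<in> D1" "snd p \<in> D1'" "fst q \<in> D2" "snd q \<in> D2'"
        using that xs R[OF z] by auto
      then show "(\<lambda>k. norm ((T1 ^^ n k) (fst p)) * norm (S (n k) (fst q))) \<longlonglongrightarrow> 0"
        and "bounded (range (\<lambda>k. l (n k) *\<^sub>C (T2 ^^ n k) (snd p)))"
        and "bounded (range (\<lambda>k. (1 / l (n k)) *\<^sub>C S' (n k) (snd q)))"
        using null bdd by blast+
    qed (rule l)
    then have "(\<lambda>k. norm (Q (n k) z)
        * norm ((T1 ^^ n k) (fst p) \<otimes>\<^sub>\<pi> (T2 ^^ n k) (snd p))) \<longlonglongrightarrow> 0" if "p \<in> set xs" for p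
      unfolding Q_def using that
      by (intro sum_list_norm_mult_tendsto_0) (auto simp: mult.commute)
    then show ?thesis
      unfolding w ptensor_map_funpow_sum_list[OF T1 T2]
      by (intro sum_list_norm_mult_tendsto_0) (auto simp: mult.commute)
  qed
  moreover have "(\<lambda>k. (?T ^^ n k) (Q (n k) z)) \<longlonglongrightarrow> z" if z: "z \<in> tensor_sums D2 D2'" for z
  proof -
    have "(\<lambda>k. (T1 ^^ n k) (S (n k) (fst p)) \<otimes>\<^sub>\<pi> (T2 ^^ n k) (S' (n k) (snd p)))
        \<longlonglongrightarrow> fst p \<otimes>\<^sub>\<pi> snd p" if "p \<in> set (R z)" for p
      using that R[OF z]
      by (intro bounded_bilinear.tendsto[OF bounded_bilinear_ptens] inv inv') auto
    then have "(\<lambda>k. (?T ^^ n k) (Q (n k) z)) \<longlonglongrightarrow> (\<Sum>p\<leftarrow>R z. fst p \<otimes>\<^sub>\<pi> snd p)"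
      unfolding Q_def ptensor_map_funpow_sum_list[OF T1 T2] by (intro tendsto_sum_list)
    then show ?thesis using R[OF z] by simp
  qed
  ultimately show ?thesis
    unfolding supercyclicity_criterion_along_def
    using bounded_clinear_ptensor_map[OF T1 T2] n closure_tensor_sums[OF D(1) D'(1)]
      closure_tensor_sums[OF D(2) D'(2)] by blast
qed

section \<open>From the criterion to supercyclicity\<close>

text \<open>
  Perturb \<open>x \<in> D1\<close> near \<open>u\<close> by a multiple of \<open>S y\<close>, with \<open>y \<in> D2\<close> near \<open>v\<close>. For
  \<open>a = \<parallel>T\<^sup>n x\<parallel>\<close> and \<open>b = \<parallel>S y\<parallel>\<close> the condition \<open>a b \<rightarrow> 0\<close> is what allows a scalar \<open>c\<close> with both \<open>c a\<close> and
  \<open>b / c\<close> small, so that \<open>x + c\<^sup>-\<^sup>1 S y\<close> remains near \<open>u\<close> while \<open>c T\<^sup>n\<close> maps it to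
  \<open>c T\<^sup>n x + T\<^sup>n S y\<close>, which is near \<open>y\<close>.
\<close>

lemma supercyclicity_criterion_transitive:
  fixes T :: "'a::complex_normed_vector \<Rightarrow> 'a"
  assumes "supercyclicity_criterion T" and "0 < e"
  obtains w c m where "dist w u < e" "dist (c *\<^sub>C (T ^^ m) w) v < e"
proof -
  obtain n D1 D2 S where T: "bounded_clinear T"
    and D: "closure D1 = UNIV" "closure D2 = UNIV"
    and null: "\<And>x y. x \<in> D1 \<Longrightarrow> y \<in> D2 \<Longrightarrow> (\<lambda>k. norm ((T ^^ n k) x) * norm (S (n k) y)) \<longlonglongrightarrow> 0"
    and inv: "\<And>y. y \<in> D2 \<Longrightarrow> (\<lambda>k. (T ^^ n k) (S (n k) y)) \<longlonglongrightarrow> y"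
    using assms(1) unfolding supercyclicity_criterion_def supercyclicity_criterion_along_def
    by blast
  define d where "d = e / 3"
  have d: "0 < d" using assms(2) by (simp add: d_def)
  obtain x where x: "x \<in> D1" "dist x u < d"
    using D(1) d by (metis UNIV_I closure_approachable)
  obtain y where y: "y \<in> D2" "dist y v < d"
    using D(2) d by (metis UNIV_I closure_approachable)
  have "\<forall>\<^sub>F k in sequentially. norm ((T ^^ n k) x) * norm (S (n k) y) < d * d"
    using order_tendstoD(2)[OF null[OF x(1) y(1)], of "d * d"] d by simp
  moreover have "\<forall>\<^sub>F k in sequentially. dist ((T ^^ n k) (S (n k) y)) y < d"
    using inv[OF y(1)] d by (rule tendstoD)
  ultimately obtain k where k: "norm ((T ^^ n k) x) * norm (S (n k) y) < d * d"
      "dist ((T ^^ n k) (S (n k) y)) y < d"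
    using eventually_happens'[OF sequentially_bot eventually_conj] by blast
  define a b where "a = norm ((T ^^ n k) x)" and "b = norm (S (n k) y)"
  have ab: "a * b < d * d" "0 \<le> a" "0 \<le> b" using k by (auto simp: a_def b_def)
  \<comment> \<open>The scalar will be \<open>c = b' / d\<close>. With \<open>b\<close> in place of \<open>b'\<close> it could vanish, and \<open>b / c\<close>
    would not be strictly below \<open>d\<close>.\<close>
  obtain b' where b': "b < b'" "a * b' < d * d"
  proof
    define h where "h = (d * d - a * b) / (a + 1)"
    have h: "0 < h" using ab by (simp add: h_def)
    then show "b < b + h" by simp
    have "(a + 1) * h = d * d - a * b" using ab by (simp add: h_def)
    then show "a * (b + h) < d * d" using h by (simp add: algebra_simps)
  qed
  define c where "c = b' / d"
  have c: "0 < c" "c * a < d" "b / c < d"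
    using b' ab d by (simp_all add: c_def pos_divide_less_eq mult.commute)
  define w where "w = x + complex_of_real (1 / c) *\<^sub>C S (n k) y"
  have lin: "clinear (T ^^ n k)"
    using bounded_clinear_funpow[OF T] by (simp add: bounded_clinear_def)
  have w_near: "dist w u < e"
  proof -
    have "dist w x = b / c" using c(1) by (simp add: w_def dist_norm norm_scaleC b_def norm_divide)
    then show ?thesis using dist_triangle[of w u x] x(2) c(3) d unfolding d_def by linarith
  qed
  have "complex_of_real c *\<^sub>C (T ^^ n k) w
      = complex_of_real c *\<^sub>C (T ^^ n k) x + (T ^^ n k) (S (n k) y)"
  proof -
    have "(T ^^ n k) w
        = (T ^^ n k) x + complex_of_real (1 / c) *\<^sub>C (T ^^ n k) (S (n k) y)"
      using lin by (simp add: w_def clinear_def)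
    then show ?thesis
      using c(1) scaleC_of_real[of 1 "(T ^^ n k) (S (n k) y)"]
      by (simp add: scaleC_add_right scaleC_scaleC)
  qed
  then have "dist (complex_of_real c *\<^sub>C (T ^^ n k) w) ((T ^^ n k) (S (n k) y)) = c * a"
    using c(1) by (simp add: dist_norm norm_scaleC a_def)
  then have "dist (complex_of_real c *\<^sub>C (T ^^ n k) w) v < e"
    using dist_triangle[of "complex_of_real c *\<^sub>C (T ^^ n k) w" v "(T ^^ n k) (S (n k) y)"]
      dist_triangle[of "(T ^^ n k) (S (n k) y)" v y] k(2) y(2) c(2)
    by (simp add: d_def)
  with w_near show ?thesis by (rule that)
qed

lemma dense_G_delta_Baire:
  fixes \<G> :: "'a::{metric_space, complete_space} set set"
  assumes "countable \<G>" "\<And>U. U \<in> \<G> \<Longrightarrow> open U \<and> closure U = UNIV"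
  shows "closure (\<Inter>\<G>) = UNIV"
  using Met_TC.metric_Baire_category[OF _ assms(1)] assms(2) complete_UNIV
  by simp

theorem supercyclicity_criterion_imp_supercyclic:
  fixes T :: "'a::complex_banach \<Rightarrow> 'a"
  assumes "separable_space (euclidean :: 'a topology)" and crit: "supercyclicity_criterion T"
  shows "supercyclic T"
proof -
  have T: "bounded_clinear T"
    using crit by (auto simp: supercyclicity_criterion_def supercyclicity_criterion_along_def)
  obtain C :: "'a set" where C: "countable C" "closure C = UNIV"
    using assms(1) by (auto simp: separable_space_euclidean_iff)
  define G where
    "G v j = (\<Union>c m. (\<lambda>x. c *\<^sub>C (T ^^ m) x) -` ball v (inverse (real (Suc j))))" for v j
  have "open (G v j) \<and> closure (G v j) = UNIV" for v j
  proof
    have "continuous_on UNIV (\<lambda>x. c *\<^sub>C (T ^^ m) x)" for c m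
    proof -
      have "bounded_clinear (\<lambda>x::'a. c *\<^sub>C x)"
        by (auto simp: bounded_clinear_def clinear_scaleC norm_scaleC)
      then have "bounded_linear (\<lambda>x. c *\<^sub>C (T ^^ m) x)"
        using bounded_linear_compose bounded_clinear_bounded_linear bounded_clinear_funpow[OF T]
        by blast
      then show ?thesis by (rule bounded_linear.continuous_on) (rule continuous_on_id)
    qed
    then show "open (G v j)"
      unfolding G_def by (intro open_UN ballI open_vimage) auto
    show "closure (G v j) = UNIV"
    proof (intro equalityI subsetI UNIV_I)
      fix u
      show "u \<in> closure (G v j)"
        unfolding closure_approachable
      proof (intro allI impI)
        fix e :: real assume "0 < e"
        then have "0 < min e (inverse (real (Suc j)))" by simp
        then obtain w c m where w: "dist w u < min e (inverse (real (Suc j)))"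
            "dist (c *\<^sub>C (T ^^ m) w) v < min e (inverse (real (Suc j)))"
          by (rule supercyclicity_criterion_transitive[OF crit])
        then have "w \<in> G v j" by (auto simp: G_def dist_commute simp del: of_nat_Suc)
        with w show "\<exists>w\<in>G v j. dist w u < e" by auto
      qed
    qed
  qed
  moreover have "countable (case_prod G ` (C \<times> UNIV))" using C(1) by simp
  ultimately have "closure (\<Inter>(case_prod G ` (C \<times> UNIV))) = UNIV"
    by (intro dense_G_delta_Baire) auto
  then have "\<Inter>(case_prod G ` (C \<times> UNIV)) \<noteq> {}" by (metis UNIV_not_empty closure_empty)
  then obtain x where x: "\<And>v j. v \<in> C \<Longrightarrow> x \<in> G v j" by auto
  have "v \<in> closure {c *\<^sub>C (T ^^ m) x | c m. True}" for v
    unfolding closure_approachable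
  proof (intro allI impI)
    fix e :: real assume "0 < e"
    then have e: "0 < e / 2" by simp
    then obtain v' where v': "v' \<in> C" "dist v' v < e / 2"
      using C(2) by (metis UNIV_I closure_approachable)
    obtain j where j: "inverse (real (Suc j)) < e / 2" using reals_Archimedean[OF e] by blast
    obtain c m where "dist v' (c *\<^sub>C (T ^^ m) x) < inverse (real (Suc j))"
      using x[OF v'(1), of j] by (auto simp: G_def)
    then have "dist (c *\<^sub>C (T ^^ m) x) v < e"
      using v'(2) j dist_triangle[of "c *\<^sub>C (T ^^ m) x" v v'] by (simp add: dist_commute)
    then show "\<exists>z\<in>{c *\<^sub>C (T ^^ m) x | c m. True}. dist z v < e" by blast
  qed
  then show ?thesis unfolding supercyclic_def using T by blast
qed

section \<open>Supercyclicity of the tensor product\<close>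

theorem theorem3p3:
  fixes T1 :: "'a::complex_banach \<Rightarrow> 'a" and T2 :: "'b::complex_banach \<Rightarrow> 'b"
    and n :: "nat \<Rightarrow> nat"
  assumes "separable_space (euclidean :: 'a topology)"
    and "separable_space (euclidean :: 'b topology)"
    and "bounded_clinear T1" and "bounded_clinear T2"
    and "supercyclicity_criterion_along n T1"
    and "tensor_supercyclicity_criterion_along n T2"
  shows "supercyclicity_criterion (ptensor_map T1 T2) \<and> supercyclic (ptensor_map T1 T2)"
proof
  show crit: "supercyclicity_criterion (ptensor_map T1 T2)"
    unfolding supercyclicity_criterion_def
    using supercyclicity_criterion_along_ptensor_map[OF assms(5,6)] by blast
  show "supercyclic (ptensor_map T1 T2)"
    using separable_space_ptensor[OF assms(1,2)] crit
    by (rule supercyclicity_criterion_imp_supercyclic)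
qed

end
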